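(* Let $(F_1,\dots,F_N)$ be a non-degenerate iterated function system of surjective maps on a complete metric space $(T,d)$, let $X=\{1,\dots,N\}^\infty$ with shift map $\sigma$, and let $L$ be the associated fractafold bundle. The local homeomorphism $\tilde\sigma:L\to L$, $\tilde\sigma(x,t)=(\sigma(x),F_{x_1}(t))$, is essentially free. Hence, the Renault–Deaconu groupoid $\tilde{\mathcal{G}}=\mathcal{G}(L,\tilde\sigma)$ associated to $\tilde\sigma$ is topologically principal.
   Context: Iterated function system: $(T,d)$ is a complete metric space and $F_1,\dots,F_N:T\to T$ are maps for which there are constants $0<r_i\le R_i<1$ with $r_i d(t,t')\le d(F_i(t),F_i(t'))\le R_i d(t,t')$ for all $t,t'\in T$ (non-degeneracy); each $F_i$ is surjective, hence a homeomorphism. $K\subset T$ is the unique (non-empty) compact set with $K=F_1(K)\cup\dots\cup F_N(K)$. Words: $W=\{1,\dots,N\}$, $W^*=\bigcup_{n\in\mathbb{N}}W^n$, and $X=W^\infty$ is the space of infinite sequences with the topology generated by the cylinders $Z(\omega)=\{x\in X:x_i=\omega_i,\ i=1,\dots,|\omega|\}$, $\omega\in W^*$. The shift is $\sigma(x_1x_2x_3\cdots)=x_2x_3\cdots$. For $\omega\in W^n$, $F_\omega=F_{\omega_n}\circ\dots\circ F_{\omega_1}$ and $F_\omega^{-1}=F_{\omega_1}^{-1}\circ\dots\circ F_{\omega_n}^{-1}$. Fractafold bundle: for $\omega\in W^n$ put $L_n(\omega)=F_\omega^{-1}(K)$; for $n\ge0$ let $L_n=\bigsqcup_{\omega\in W^n}Z(\omega)\times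 L_n(\omega)\subset X\times T$ with the subspace topology. Then $L_n\subset L_{n+1}$, and $L=\bigcup_{n\ge0}L_n$ with the inductive limit topology: $U\subset L$ is open iff $U\cap L_n$ is open in $L_n$ for every $n\ge0$. Renault–Deaconu groupoid: for a local homeomorphism $\tau:Y\to Y$ of a Hausdorff space $Y$, $$\mathcal{G}(Y,\tau)=\{(x,m-n,y)\in Y\times\mathbb{Z}\times Y:\ m,n\ge 0,\ \tau^m(x)=\tau^n(y)\},$$ with $(x,m,y)(y,n,w)=(x,m+n,w)$, $(x,n,y)^{-1}=(y,-n,x)$, $r(x,n,y)=x$, $s(x,n,y)=y$ (unit space identified with $Y$ via $(x,0,x)\mapsto x$). A basis for the topology consists of the sets $\{(x,m-n,y):\tau^m(x)=\tau^n(y),\ x\in U,\ y\in V\}$, where $m,n\in\mathbb{N}$, $U,V\subset Y$ are open, $\tau^m|_U$ and $\tau^n|_V$ are injective, and $\tau^m(U)=\tau^n(V)$. A local homeomorphism $\tau$ on a topological space $Y$ is essentially free if $\{z\in Y:\forall k,l\ge0,\ \tau^k(z)=\tau^l(z)\Rightarrow k=l\}$ is dense in $Y$. A topological groupoid $G$ is topologically principal if the set of units with trivial isotropy, $\{x\in G^0: s(\gamma)=r(\gamma)=x \text{ only if } \gamma=x\}$, is dense in $G^0$.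
   Formalization: The formal statement assumes N ≥ 2: for N = 1 the bundle L is a single point, the shift on L is the identity, and the claim is false. *)

theory Defs
  imports "HOL-Analysis.Analysis" "HOL-Library.Stream"
begin

definition nondegenerate_ifs :: "nat \<Rightarrow> (nat \<Rightarrow> 't::metric_space \<Rightarrow> 't) \<Rightarrow> bool" where
  "nondegenerate_ifs N F \<longleftrightarrow>
     (\<forall>i\<in>{1..N}. \<exists>r R. 0 < r \<and> r \<le> R \<and> R < 1 \<and>
        (\<forall>t t'. r * dist t t' \<le> dist (F i t) (F i t') \<and> dist (F i t) (F i t') \<le> R * dist t t'))"

text \<open>For a complete space and \<open>N \<ge> 1\<close> there is exactly one such set.\<close>

definition is_attractor :: "nat \<Rightarrow> (nat \<Rightarrow> 't::metric_space \<Rightarrow> 't) \<Rightarrow> 't set \<Rightarrow> bool" where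
  "is_attractor N F K \<longleftrightarrow> compact K \<and> K \<noteq> {} \<and> K = (\<Union>i\<in>{1..N}. F i ` K)"

text \<open>
  The set \<open>X\<close> is \<^term>\<open>streams {1..N}\<close>, and the shift map is \<^const>\<open>stl\<close>.
\<close>

definition words :: "nat \<Rightarrow> nat \<Rightarrow> nat list set" where
  "words N n = {\<omega>. set \<omega> \<subseteq> {1..N} \<and> length \<omega> = n}"

definition cylinder :: "nat \<Rightarrow> nat list \<Rightarrow> nat stream set" where
  "cylinder N \<omega> = {x \<in> streams {1..N}. stake (length \<omega>) x = \<omega>}"

definition shift_space :: "nat \<Rightarrow> nat stream topology" where
  "shift_space N = topology_generated_by (\<Union>n. cylinder N ` words N n)"

text \<open>
  The order of composition is that of \<^const>\<open>fold\<close>: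
  \<open>fold F [i\<^sub>1, \<dots>, i\<^sub>n] = F i\<^sub>n \<circ> \<dots> \<circ> F i\<^sub>1\<close>.
\<close>

definition fractal_blowup :: "(nat \<Rightarrow> 't \<Rightarrow> 't) \<Rightarrow> 't set \<Rightarrow> nat list \<Rightarrow> 't set" where
  "fractal_blowup F K \<omega> = fold F \<omega> -` K"

definition bundle_level ::
    "nat \<Rightarrow> (nat \<Rightarrow> 't \<Rightarrow> 't) \<Rightarrow> 't set \<Rightarrow> nat \<Rightarrow> (nat stream \<times> 't) set" where
  "bundle_level N F K n = (\<Union>\<omega>\<in>words N n. cylinder N \<omega> \<times> fractal_blowup F K \<omega>)"

definition bundle_level_top ::
    "nat \<Rightarrow> (nat \<Rightarrow> 't::topological_space \<Rightarrow> 't) \<Rightarrow> 't set \<Rightarrow> nat \<Rightarrow> (nat stream \<times> 't) topology" where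
  "bundle_level_top N F K n =
     subtopology (prod_topology (shift_space N) euclidean) (bundle_level N F K n)"

definition fractafold_bundle ::
    "nat \<Rightarrow> (nat \<Rightarrow> 't::topological_space \<Rightarrow> 't) \<Rightarrow> 't set \<Rightarrow> (nat stream \<times> 't) topology" where
  "fractafold_bundle N F K =
     topology (\<lambda>U. U \<subseteq> (\<Union>n. bundle_level N F K n) \<and>
       (\<forall>n. openin (bundle_level_top N F K n) (U \<inter> bundle_level N F K n)))"

lemma openin_fractafold_bundle:
  "openin (fractafold_bundle N F K) U \<longleftrightarrow>
     U \<subseteq> (\<Union>n. bundle_level N F K n) \<and>
     (\<forall>n. openin (bundle_level_top N F K n) (U \<inter> bundle_level N F K n))"
proof -
  let ?L = "bundle_level N F K" and ?T = "bundle_level_top N F K"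
  have "istopology (\<lambda>U. U \<subseteq> (\<Union>n. ?L n) \<and> (\<forall>n. openin (?T n) (U \<inter> ?L n)))"
    unfolding istopology_def
  proof (rule conjI; intro allI impI)
    fix S S'
    assume S: "S \<subseteq> (\<Union>n. ?L n) \<and> (\<forall>n. openin (?T n) (S \<inter> ?L n))"
      and S': "S' \<subseteq> (\<Union>n. ?L n) \<and> (\<forall>n. openin (?T n) (S' \<inter> ?L n))"
    have "openin (?T n) (S \<inter> S' \<inter> ?L n)" for n
    proof -
      have "openin (?T n) ((S \<inter> ?L n) \<inter> (S' \<inter> ?L n))"
        by (rule openin_Int; use S S' in simp)
      also have "(S \<inter> ?L n) \<inter> (S' \<inter> ?L n) = S \<inter> S' \<inter> ?L n"
        by blast
      finally show ?thesis .
    qed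
    then show "S \<inter> S' \<subseteq> (\<Union>n. ?L n) \<and> (\<forall>n. openin (?T n) (S \<inter> S' \<inter> ?L n))"
      using S by (meson Int_lower1 order_trans)
  next
    fix \<U>
    assume *: "\<forall>S\<in>\<U>. S \<subseteq> (\<Union>n. ?L n) \<and> (\<forall>n. openin (?T n) (S \<inter> ?L n))"
    have "openin (?T n) (\<Union>\<U> \<inter> ?L n)" for n
      unfolding Int_Union2 by (rule openin_Union) (use * in blast)
    then show "\<Union>\<U> \<subseteq> (\<Union>n. ?L n) \<and> (\<forall>n. openin (?T n) (\<Union>\<U> \<inter> ?L n))"
      using * by (meson Sup_least)
  qed
  then show ?thesis
    by (simp only: fractafold_bundle_def topology_inverse')
qed

definition bundle_shift ::
    "(nat \<Rightarrow> 't \<Rightarrow> 't) \<Rightarrow> nat stream \<times> 't \<Rightarrow> nat stream \<times> 't" where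
  "bundle_shift F = (\<lambda>(x, t). (stl x, F (shd x) t))"

definition local_homeomorphism :: "'a topology \<Rightarrow> 'b topology \<Rightarrow> ('a \<Rightarrow> 'b) \<Rightarrow> bool" where
  "local_homeomorphism Y Z f \<longleftrightarrow>
     f ` topspace Y \<subseteq> topspace Z \<and>
     (\<forall>y\<in>topspace Y. \<exists>U. openin Y U \<and> y \<in> U \<and> openin Z (f ` U) \<and>
        homeomorphic_map (subtopology Y U) (subtopology Z (f ` U)) f)"

definition essentially_free :: "'a topology \<Rightarrow> ('a \<Rightarrow> 'a) \<Rightarrow> bool" where
  "essentially_free Y \<tau> \<longleftrightarrow>
     Y closure_of {z \<in> topspace Y. \<forall>k l. (\<tau> ^^ k) z = (\<tau> ^^ l) z \<longrightarrow> k = l} = topspace Y"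

text \<open>
  The range and source maps take values in the set of arrows, units being
  arrows themselves. The value of \<open>gmult g h\<close> is only meaningful for
  composable arrows, that is, when \<open>gsrc g = grng h\<close>.
\<close>

record 'g groupoid_data =
  arrows :: "'g set"
  grng :: "'g \<Rightarrow> 'g"
  gsrc :: "'g \<Rightarrow> 'g"
  gmult :: "'g \<Rightarrow> 'g \<Rightarrow> 'g"
  ginv :: "'g \<Rightarrow> 'g"
  gtop :: "'g topology"

definition gunits :: "'g groupoid_data \<Rightarrow> 'g set" where
  "gunits G = gsrc G ` arrows G"

definition topologically_principal :: "'g groupoid_data \<Rightarrow> bool" where
  "topologically_principal G \<longleftrightarrow>
     subtopology (gtop G) (gunits G) closure_of
       {u \<in> gunits G. \<forall>\<gamma>\<in>arrows G. gsrc G \<gamma> = u \<and> grng G \<gamma> = u \<longrightarrow> \<gamma> = u} = gunits G"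

definition RD_arrows :: "'a topology \<Rightarrow> ('a \<Rightarrow> 'a) \<Rightarrow> ('a \<times> int \<times> 'a) set" where
  "RD_arrows Y \<tau> =
     {(x, int m - int n, y) | x m n y.
        x \<in> topspace Y \<and> y \<in> topspace Y \<and> (\<tau> ^^ m) x = (\<tau> ^^ n) y}"

definition RD_basic_set ::
    "('a \<Rightarrow> 'a) \<Rightarrow> nat \<Rightarrow> nat \<Rightarrow> 'a set \<Rightarrow> 'a set \<Rightarrow> ('a \<times> int \<times> 'a) set" where
  "RD_basic_set \<tau> m n U V =
     {(x, int m - int n, y) | x y. (\<tau> ^^ m) x = (\<tau> ^^ n) y \<and> x \<in> U \<and> y \<in> V}"

definition RD_basis :: "'a topology \<Rightarrow> ('a \<Rightarrow> 'a) \<Rightarrow> ('a \<times> int \<times> 'a) set set" where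
  "RD_basis Y \<tau> =
     {RD_basic_set \<tau> m n U V | m n U V.
        openin Y U \<and> openin Y V \<and> inj_on (\<tau> ^^ m) U \<and> inj_on (\<tau> ^^ n) V \<and>
        (\<tau> ^^ m) ` U = (\<tau> ^^ n) ` V}"

definition RD_groupoid :: "'a topology \<Rightarrow> ('a \<Rightarrow> 'a) \<Rightarrow> ('a \<times> int \<times> 'a) groupoid_data" where
  "RD_groupoid Y \<tau> =
     \<lparr> arrows = RD_arrows Y \<tau>,
       grng = (\<lambda>(x, k, y). (x, 0, x)),
       gsrc = (\<lambda>(x, k, y). (y, 0, y)),
       gmult = (\<lambda>(x, k, y) (y', l, w). (x, k + l, w)),
       ginv = (\<lambda>(x, k, y). (y, - k, x)),
       gtop = topology_generated_by (RD_basis Y \<tau>) \<rparr>"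

end

theory Submission
  imports Defs
begin

text \<open>
  Write \<open>\<tau>(x, t) = (\<sigma>(x), F\<^bsub>x\<^sub>1\<^esub>(t))\<close>.
  Since \<open>\<tau>(x, t) \<in> L\<^sub>n\<close> iff \<open>(x, t) \<in> L\<^bsub>n+1\<^esub>\<close>, the map \<open>\<tau>\<close> is continuous and open on \<open>L\<close> because it is
  so on \<open>X \<times> T\<close>, and it is injective on each open set \<open>{x\<^sub>1 = i}\<close>.
  A basic neighbourhood of \<open>(x, t)\<close> in \<open>L\<close> contains \<open>(y, t)\<close> for every \<open>y\<close> that agrees with \<open>x\<close> on a
  long enough prefix, and as \<open>N \<ge> 2\<close> such a \<open>y\<close> can be chosen not eventually periodic; then \<open>(y, t)\<close>
  has pairwise distinct iterates. Finally, \<open>y \<mapsto> (y, 0, y)\<close> is continuous from \<open>L\<close> into the groupoid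
  and so maps dense sets to dense sets of units.
\<close>

section \<open>Open sets of the shift space\<close>

lemma mem_cylinder_stake:
  "y \<in> cylinder N (stake n x) \<longleftrightarrow> y \<in> streams {1..N} \<and> stake n y = stake n x"
  by (simp add: cylinder_def)

lemma mem_cylinder_stake_Suc:
  "y \<in> cylinder N (stake (Suc n) x) \<longleftrightarrow>
     y \<in> streams {1..N} \<and> shd y = shd x \<and> stake n (stl y) = stake n (stl x)"
  by (simp add: cylinder_def)

lemma stake_eq_mono: "stake n y = stake n x \<Longrightarrow> m \<le> n \<Longrightarrow> stake m y = stake m x"
  by (metis min.absorb_iff1 take_stake)

lemma cylinder_stake_mono: "m \<le> n \<Longrightarrow> cylinder N (stake n x) \<subseteq> cylinder N (stake m x)"
  using stake_eq_mono by (auto simp: mem_cylinder_stake)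

lemma set_stake_subset: "x \<in> streams A \<Longrightarrow> set (stake n x) \<subseteq> A"
  by (induction n arbitrary: x) (auto simp: streams_stl streams_shd)

lemma stake_in_words: "x \<in> streams {1..N} \<Longrightarrow> stake n x \<in> words N n"
  by (simp only: words_def mem_Collect_eq length_stake set_stake_subset simp_thms)

text \<open>Along the prefixes of a point \<open>x\<close> the cylinders decrease, so two
  neighbourhoods that each contain one of them share the cylinder of the longer prefix. This settles
  finite intersections; unions are immediate.\<close>

lemma openin_shift_space:
  "openin (shift_space N) S \<longleftrightarrow>
     S \<subseteq> streams {1..N} \<and> (\<forall>x\<in>S. \<exists>n. cylinder N (stake n x) \<subseteq> S)"
proof
  assume "openin (shift_space N) S"
  then have "generate_topology_on (\<Union>n. cylinder N ` words N n) S"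
    by (simp add: shift_space_def openin_topology_generated_by_iff)
  then show "S \<subseteq> streams {1..N} \<and> (\<forall>x\<in>S. \<exists>n. cylinder N (stake n x) \<subseteq> S)"
  proof induction
    case (Int a b)
    have "\<exists>n. cylinder N (stake n x) \<subseteq> a \<inter> b" if x: "x \<in> a \<inter> b" for x
    proof -
      obtain m n where "cylinder N (stake m x) \<subseteq> a" "cylinder N (stake n x) \<subseteq> b"
        using Int.IH x by blast
      then have "cylinder N (stake (max m n) x) \<subseteq> a \<inter> b"
        using cylinder_stake_mono[of m "max m n" N x] cylinder_stake_mono[of n "max m n" N x]
        by auto
      then show ?thesis ..
    qed
    then show ?case using Int.IH by blast
  next
    case (UN K)
    then show ?case by (meson Sup_upper Sup_least UnionE order_trans)
  next
    case (Basis s)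
    then obtain n \<omega> where "\<omega> \<in> words N n" and s: "s = cylinder N \<omega>" by blast
    then have "length \<omega> = n" by (simp add: words_def)
    \<comment> \<open>Any cylinder that contains \<open>x\<close> is the cylinder of a prefix of
      \<open>x\<close>.\<close>
    then have "cylinder N (stake n x) \<subseteq> s" if "x \<in> s" for x
      using that by (auto simp: s cylinder_def)
    then show ?case by (auto simp: s cylinder_def)
  qed simp
next
  assume S: "S \<subseteq> streams {1..N} \<and> (\<forall>x\<in>S. \<exists>n. cylinder N (stake n x) \<subseteq> S)"
  have "\<exists>T. openin (shift_space N) T \<and> x \<in> T \<and> T \<subseteq> S" if x: "x \<in> S" for x
  proof -
    obtain n where n: "cylinder N (stake n x) \<subseteq> S" using S x by blast
    have "openin (shift_space N) (cylinder N (stake n x))"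
      unfolding shift_space_def
      by (rule topology_generated_by_Basis) (use S x stake_in_words in blast)
    moreover have "x \<in> cylinder N (stake n x)" using S x by (auto simp: mem_cylinder_stake)
    ultimately show ?thesis using n by blast
  qed
  then show "openin (shift_space N) S" by (subst openin_subopen) blast
qed

lemma openin_cylinder_stake: "openin (shift_space N) (cylinder N (stake n x))"
  unfolding openin_shift_space by (metis mem_cylinder_stake order_refl subsetI)

lemma openin_shift_prod:
  fixes W :: "(nat stream \<times> 't::topological_space) set"
  shows "openin (prod_topology (shift_space N) euclidean) W \<longleftrightarrow>
     W \<subseteq> streams {1..N} \<times> UNIV \<and>
     (\<forall>(x, t)\<in>W. \<exists>n V. open V \<and> t \<in> V \<and> cylinder N (stake n x) \<times> V \<subseteq> W)"
proof
  assume W: "openin (prod_topology (shift_space N) euclidean) W"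
  show "W \<subseteq> streams {1..N} \<times> UNIV \<and>
     (\<forall>(x, t)\<in>W. \<exists>n V. open V \<and> t \<in> V \<and> cylinder N (stake n x) \<times> V \<subseteq> W)"
  proof (intro conjI ballI subsetI; clarify)
    fix x t assume "(x, t) \<in> W"
    then obtain S V where S: "openin (shift_space N) S" and V: "open V" "x \<in> S" "t \<in> V" "S \<times> V \<subseteq> W"
      using W unfolding openin_prod_topology_alt by force
    then obtain n where "cylinder N (stake n x) \<subseteq> S" by (meson openin_shift_space)
    with V show "\<exists>n V. open V \<and> t \<in> V \<and> cylinder N (stake n x) \<times> V \<subseteq> W" by blast
    show "x \<in> streams {1..N} \<and> t \<in> UNIV" using S V openin_shift_space by blast
  qed
next
  assume W: "W \<subseteq> streams {1..N} \<times> UNIV \<and>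
     (\<forall>(x, t)\<in>W. \<exists>n V. open V \<and> t \<in> V \<and> cylinder N (stake n x) \<times> V \<subseteq> W)"
  show "openin (prod_topology (shift_space N) euclidean) W"
    unfolding openin_prod_topology_alt
  proof (intro allI impI)
    fix x t assume xt: "(x, t) \<in> W"
    then obtain n V where "open V" "t \<in> V" "cylinder N (stake n x) \<times> V \<subseteq> W"
      using W by fast
    moreover have "x \<in> cylinder N (stake n x)" using W xt by (auto simp: mem_cylinder_stake)
    ultimately show "\<exists>U V. openin (shift_space N) U \<and> openin euclidean V \<and>
        x \<in> U \<and> t \<in> V \<and> U \<times> V \<subseteq> W"
      by (intro exI[of _ "cylinder N (stake n x)"] exI[of _ V])
        (simp add: openin_cylinder_stake)
  qed
qed

section \<open>The levels of the fractafold bundle\<close>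

text \<open>The union over words collapses: the only word of length \<open>n\<close> whose cylinder
  contains \<open>x\<close> is the prefix \<open>stake n x\<close>.\<close>

lemma mem_bundle_level:
  "(x, t) \<in> bundle_level N F K n \<longleftrightarrow> x \<in> streams {1..N} \<and> fold F (stake n x) t \<in> K"
proof
  assume "(x, t) \<in> bundle_level N F K n"
  then show "x \<in> streams {1..N} \<and> fold F (stake n x) t \<in> K"
    by (auto simp: bundle_level_def cylinder_def fractal_blowup_def words_def)
next
  assume *: "x \<in> streams {1..N} \<and> fold F (stake n x) t \<in> K"
  then have "(x, t) \<in> cylinder N (stake n x) \<times> fractal_blowup F K (stake n x)"
    by (simp add: mem_cylinder_stake fractal_blowup_def)
  moreover have "stake n x \<in> words N n" using * stake_in_words by blast
  ultimately show "(x, t) \<in> bundle_level N F K n"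
    unfolding bundle_level_def by blast
qed

lemma bundle_level_subset: "bundle_level N F K n \<subseteq> streams {1..N} \<times> UNIV"
  by (auto simp: mem_bundle_level)

text \<open>Folding along a prefix of \<open>x\<close> applies \<open>F (shd x)\<close> first and
  then folds along a prefix of \<open>stl x\<close>; the bundle shift merely carries out that first
  step in advance.\<close>

lemma bundle_shift_mem_level:
  assumes "x \<in> streams {1..N}"
  shows "bundle_shift F (x, t) \<in> bundle_level N F K n \<longleftrightarrow> (x, t) \<in> bundle_level N F K (Suc n)"
  using assms by (simp add: bundle_shift_def mem_bundle_level streams_stl)

text \<open>The preimages of the levels under the bundle shift start at level \<open>1\<close>. This
  inclusion lets points of level \<open>0\<close> be treated there.\<close>

lemma bundle_level_0_subset_1:
  assumes "\<And>i. i \<in> {1..N} \<Longrightarrow> F i ` K \<subseteq> K"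
  shows "bundle_level N F K 0 \<subseteq> bundle_level N F K (Suc 0)"
proof clarify
  fix x t assume "(x, t) \<in> bundle_level N F K 0"
  then have x: "x \<in> streams {1..N}" and t: "t \<in> K" by (simp_all add: mem_bundle_level)
  from assms[OF streams_shd[OF x]] t have "F (shd x) t \<in> K" by blast
  with x show "(x, t) \<in> bundle_level N F K (Suc 0)" by (simp add: mem_bundle_level)
qed

lemma openin_bundle_level_top:
  "openin (bundle_level_top N F K n) S \<longleftrightarrow>
     (\<exists>W. openin (prod_topology (shift_space N) euclidean) W \<and> S = W \<inter> bundle_level N F K n)"
  by (simp add: bundle_level_top_def openin_subtopology)

text \<open>The inductive limit topology is at least as fine as the subspace topology: on every
  level the trace is that of the same \<open>W\<close>.\<close>

lemma openin_fractafold_bundle_Int: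
  assumes "openin (prod_topology (shift_space N) euclidean) W"
  shows "openin (fractafold_bundle N F K) (W \<inter> (\<Union>n. bundle_level N F K n))"
  unfolding openin_fractafold_bundle openin_bundle_level_top using assms by blast

lemma topspace_fractafold_bundle [simp]:
  fixes F :: "nat \<Rightarrow> 't::topological_space \<Rightarrow> 't"
  shows "topspace (fractafold_bundle N F K) = (\<Union>n. bundle_level N F K n)"
proof
  show "topspace (fractafold_bundle N F K) \<subseteq> (\<Union>n. bundle_level N F K n)"
    by (metis openin_fractafold_bundle openin_topspace)
  \<comment> \<open>The empty prefix gives the whole shift space, so \<open>X \<times> T\<close> is
    open in itself by the criterion above, and its trace on \<open>L\<close> is all of
    \<open>L\<close>.\<close>
  have "cylinder N (stake 0 x) \<times> (UNIV :: 't set) \<subseteq> streams {1..N} \<times> UNIV" for x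
    by (auto simp: cylinder_def)
  then have "openin (prod_topology (shift_space N) euclidean)
      (streams {1..N} \<times> (UNIV :: 't set))"
    unfolding openin_shift_prod using open_UNIV by blast
  then have "openin (fractafold_bundle N F K)
      (streams {1..N} \<times> UNIV \<inter> (\<Union>n. bundle_level N F K n))"
    by (rule openin_fractafold_bundle_Int)
  also have "streams {1..N} \<times> UNIV \<inter> (\<Union>n. bundle_level N F K n) = (\<Union>n. bundle_level N F K n)"
    using bundle_level_subset by fast
  finally show "(\<Union>n. bundle_level N F K n) \<subseteq> topspace (fractafold_bundle N F K)"
    by (rule openin_subset)
qed

section \<open>The bundle shift is a local homeomorphism\<close>

text \<open>An open set on which \<open>f\<close> is injective serves as a chart: there
  \<open>f\<close> is a continuous open bijection onto an open image.\<close>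

lemma local_homeomorphismI:
  assumes "continuous_map Y Z f" "open_map Y Z f"
    and inj: "\<And>y. y \<in> topspace Y \<Longrightarrow> \<exists>U. openin Y U \<and> y \<in> U \<and> inj_on f U"
  shows "local_homeomorphism Y Z f"
  unfolding local_homeomorphism_def
proof (intro conjI ballI)
  show "f ` topspace Y \<subseteq> topspace Z"
    using assms(1) by (simp add: continuous_map_image_subset_topspace)
next
  fix y assume "y \<in> topspace Y"
  then obtain U where U: "openin Y U" "y \<in> U" "inj_on f U" using inj by blast
  have fU: "openin Z (f ` U)" using assms(2) U(1) by (simp add: open_map_def)
  have top: "topspace (subtopology Y U) = U" "topspace (subtopology Z (f ` U)) = f ` U"
    using U(1) fU by (meson openin_subset topspace_subtopology_subset)+
  have "homeomorphic_map (subtopology Y U) (subtopology Z (f ` U)) f"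
  proof (rule bijective_open_imp_homeomorphic_map)
    show "continuous_map (subtopology Y U) (subtopology Z (f ` U)) f"
      using assms(1) by (auto simp: continuous_map_in_subtopology continuous_map_from_subtopology)
    show "open_map (subtopology Y U) (subtopology Z (f ` U)) f"
      using assms(2) U(1) fU unfolding open_map_def
      by (metis image_mono openin_open_subtopology)
  qed (use U(3) top in simp_all)
  with U fU show "\<exists>U. openin Y U \<and> y \<in> U \<and> openin Z (f ` U) \<and>
      homeomorphic_map (subtopology Y U) (subtopology Z (f ` U)) f" by blast
qed

section \<open>Metric consequences of non-degeneracy\<close>

lemma nondegenerate_ifs_continuous:
  assumes "nondegenerate_ifs N F" "i \<in> {1..N}"
  shows "continuous_on UNIV (F i)"
proof -
  obtain R where "0 \<le> R" "\<And>t t'. dist (F i t) (F i t') \<le> R * dist t t'"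
    using assms unfolding nondegenerate_ifs_def
    by (metis less_eq_real_def order_trans)
  then have "R-lipschitz_on UNIV (F i)" by (intro lipschitz_onI) auto
  then show ?thesis by (rule lipschitz_on_continuous_on)
qed

lemma nondegenerate_ifs_inj:
  assumes "nondegenerate_ifs N F" "i \<in> {1..N}"
  shows "inj (F i)"
proof (rule injI)
  fix a b assume eq: "F i a = F i b"
  obtain r where "0 < r" "\<And>t t'. r * dist t t' \<le> dist (F i t) (F i t')"
    using assms unfolding nondegenerate_ifs_def by meson
  then have "r * dist a b \<le> 0" "0 < r" using eq by (metis dist_self)+
  then show "a = b" by (simp add: mult_le_0_iff)
qed

text \<open>By surjectivity every point near \<open>F i v\<close> is some \<open>F i u\<close>, and
  the lower bound \<open>r\<close> makes \<open>dist u v < e\<close> as soon as the images are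
  closer than \<open>r * e\<close>.\<close>

lemma nondegenerate_ifs_open_image:
  assumes "nondegenerate_ifs N F" "i \<in> {1..N}" "surj (F i)" "open V"
  shows "open (F i ` V)"
  unfolding open_dist
proof
  fix s assume "s \<in> F i ` V"
  then obtain v where v: "v \<in> V" "s = F i v" by blast
  obtain r where r: "0 < r" "\<And>t t'. r * dist t t' \<le> dist (F i t) (F i t')"
    using assms unfolding nondegenerate_ifs_def by meson
  obtain e where e: "0 < e" "\<And>y. dist y v < e \<Longrightarrow> y \<in> V"
    using assms(4) v unfolding open_dist by blast
  have "y \<in> F i ` V" if y: "dist y s < r * e" for y
  proof -
    obtain u where u: "y = F i u" using assms(3) by (metis surjD)
    then have "r * dist u v < r * e" using r(2)[of u v] y v by simp
    then show ?thesis using r(1) e(2) u by simp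
  qed
  then show "\<exists>e>0. \<forall>y. dist y s < e \<longrightarrow> y \<in> F i ` V"
    using r(1) e(1) by (meson mult_pos_pos)
qed

section \<open>The bundle shift on the product \<open>X \<times> T\<close>\<close>

text \<open>Near \<open>(x, t)\<close> the first letter is constant, so the map is the shift times
  the single continuous map \<open>F (shd x)\<close>. Fixing that letter as well as \<open>n\<close>
  letters of \<open>stl x\<close> takes a prefix of length \<open>Suc n\<close>.\<close>

lemma bundle_shift_vimage_open:
  assumes "nondegenerate_ifs N F" "openin (prod_topology (shift_space N) euclidean) W"
  shows "openin (prod_topology (shift_space N) euclidean)
    {z \<in> streams {1..N} \<times> UNIV. bundle_shift F z \<in> W}"
  unfolding openin_shift_prod
proof (intro conjI ballI; clarify)
  fix x t assume x: "x \<in> streams {1..N}" and xt: "bundle_shift F (x, t) \<in> W"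
  then obtain n V where V: "open V" "F (shd x) t \<in> V" "cylinder N (stake n (stl x)) \<times> V \<subseteq> W"
    using assms(2) unfolding openin_shift_prod bundle_shift_def by fastforce
  have "open (F (shd x) -` V)"
    using nondegenerate_ifs_continuous[OF assms(1) streams_shd[OF x]] V(1)
    by (simp add: open_vimage)
  moreover have "cylinder N (stake (Suc n) x) \<times> (F (shd x) -` V)
      \<subseteq> {z \<in> streams {1..N} \<times> UNIV. bundle_shift F z \<in> W}"
  proof clarify
    fix y s assume "y \<in> cylinder N (stake (Suc n) x)" and s: "F (shd x) s \<in> V"
    then have y: "y \<in> streams {1..N}" "shd y = shd x" "stake n (stl y) = stake n (stl x)"
      by (simp_all only: mem_cylinder_stake_Suc)
    then have "stl y \<in> cylinder N (stake n (stl x))"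
      by (simp only: mem_cylinder_stake streams_stl simp_thms)
    then have "(stl y, F (shd x) s) \<in> W" using V(3) s by blast
    then show "(y, s) \<in> streams {1..N} \<times> UNIV \<and> bundle_shift F (y, s) \<in> W"
      using y(1,2) by (simp add: bundle_shift_def)
  qed
  ultimately show "\<exists>n V. open V \<and> t \<in> V \<and> cylinder N (stake n x) \<times> V
      \<subseteq> {z \<in> streams {1..N} \<times> UNIV. bundle_shift F z \<in> W}"
    using V(2) by (meson vimageI2)
qed

lemma bundle_shift_image_open:
  assumes "nondegenerate_ifs N F" "\<forall>i\<in>{1..N}. surj (F i)"
    and W: "openin (prod_topology (shift_space N) euclidean) W"
  shows "openin (prod_topology (shift_space N) euclidean) (bundle_shift F ` W)"
  unfolding openin_shift_prod
proof (intro conjI ballI)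
  show "bundle_shift F ` W \<subseteq> streams {1..N} \<times> UNIV"
    using W by (auto simp: openin_shift_prod bundle_shift_def streams_stl)
next
  fix z assume "z \<in> bundle_shift F ` W"
  then obtain x t where xt: "(x, t) \<in> W" and z: "z = (stl x, F (shd x) t)"
    by (auto simp: bundle_shift_def)
  have "x \<in> streams {1..N}" using W xt by (auto simp: openin_shift_prod)
  then have i: "shd x \<in> {1..N}" by (rule streams_shd)
  obtain n V where V: "open V" "t \<in> V" "cylinder N (stake n x) \<times> V \<subseteq> W"
    using W xt unfolding openin_shift_prod by fast
  have "open (F (shd x) ` V)"
    using nondegenerate_ifs_open_image assms(1,2) i V(1) by blast
  \<comment> \<open>Prepending \<open>shd x\<close> produces a preimage. It agrees with
    \<open>x\<close> on \<open>Suc n\<close> letters, hence on the \<open>n\<close> letters that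
    keep it in \<open>W\<close>.\<close>
  moreover have "cylinder N (stake n (stl x)) \<times> F (shd x) ` V \<subseteq> bundle_shift F ` W"
  proof clarify
    fix y v assume y: "y \<in> cylinder N (stake n (stl x))" and v: "v \<in> V"
    have "shd x ## y \<in> cylinder N (stake (Suc n) x)"
      using i y unfolding mem_cylinder_stake_Suc mem_cylinder_stake by (simp add: streams_Stream)
    then have "(shd x ## y, v) \<in> W" using V(3) v cylinder_stake_mono[of n "Suc n" N x] by auto
    then show "(y, F (shd x) v) \<in> bundle_shift F ` W"
      by (rule rev_image_eqI) (simp add: bundle_shift_def)
  qed
  ultimately show "case z of (x, t) \<Rightarrow> \<exists>n V. open V \<and> t \<in> V \<and>
      cylinder N (stake n x) \<times> V \<subseteq> bundle_shift F ` W"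
    using V(2) unfolding z by blast
qed

section \<open>Passage to the inductive limit topology\<close>

text \<open>Level \<open>Suc m\<close> is mapped into level \<open>m\<close>, where the open set
  \<open>V\<close> agrees with a product-open \<open>W\<close>; so on level \<open>Suc m\<close> the
  preimages of \<open>V\<close> and \<open>W\<close> agree. Level \<open>0\<close> inherits openness
  from level \<open>1\<close>.\<close>

lemma continuous_map_bundle_shift:
  assumes "nondegenerate_ifs N F" "\<And>i. i \<in> {1..N} \<Longrightarrow> F i ` K \<subseteq> K"
  shows "continuous_map (fractafold_bundle N F K) (fractafold_bundle N F K) (bundle_shift F)"
proof -
  let ?L = "bundle_level N F K" and ?P = "prod_topology (shift_space N) euclidean"
  have L01: "?L 0 \<subseteq> ?L (Suc 0)" using assms(2) by (rule bundle_level_0_subset_1)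
  have maps: "bundle_shift F z \<in> (\<Union>n. ?L n)" if "z \<in> ?L n" for n z
  proof -
    obtain x t where z: "z = (x, t)" by (cases z)
    then have x: "x \<in> streams {1..N}" using that by (simp add: mem_bundle_level)
    \<comment> \<open>Truncated subtraction: for \<open>n = 0\<close> this is the inclusion of level
      \<open>0\<close> in level \<open>1\<close>; for \<open>n > 0\<close> the level is
      unchanged.\<close>
    have "z \<in> ?L (Suc (n - 1))" using that L01 by (cases n) auto
    then have "bundle_shift F z \<in> ?L (n - 1)" using x unfolding z by (simp only: bundle_shift_mem_level)
    then show ?thesis by blast
  qed
  have "openin (fractafold_bundle N F K) {z \<in> (\<Union>n. ?L n). bundle_shift F z \<in> V}" (is "openin _ ?U")
    if V: "openin (fractafold_bundle N F K) V" for V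
    unfolding openin_fractafold_bundle
  proof (intro conjI allI)
    have level_Suc: "\<exists>W. openin ?P W \<and> ?U \<inter> ?L (Suc m) = W \<inter> ?L (Suc m)" for m
    proof -
      obtain W where W: "openin ?P W" "V \<inter> ?L m = W \<inter> ?L m"
        using V unfolding openin_fractafold_bundle openin_bundle_level_top by blast
      have "bundle_shift F z \<in> V \<longleftrightarrow> bundle_shift F z \<in> W" if "z \<in> ?L (Suc m)" for z
      proof -
        have "bundle_shift F z \<in> ?L m"
          using that by (cases z) (simp add: bundle_shift_mem_level mem_bundle_level)
        then show ?thesis using W(2) by blast
      qed
      then have "?U \<inter> ?L (Suc m)
          = {z \<in> streams {1..N} \<times> UNIV. bundle_shift F z \<in> W} \<inter> ?L (Suc m)"
        using bundle_level_subset by blast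
      then show ?thesis using bundle_shift_vimage_open[OF assms(1) W(1)] by blast
    qed
    fix n
    show "openin (bundle_level_top N F K n) (?U \<inter> ?L n)"
    proof (cases n)
      case 0
      obtain W where "openin ?P W" "?U \<inter> ?L (Suc 0) = W \<inter> ?L (Suc 0)" using level_Suc by blast
      moreover from this have "?U \<inter> ?L 0 = W \<inter> ?L 0" using L01 by blast
      ultimately show ?thesis unfolding 0 openin_bundle_level_top by blast
    next
      case (Suc m)
      show ?thesis unfolding Suc openin_bundle_level_top by (rule level_Suc)
    qed
  qed blast
  then show ?thesis unfolding continuous_map topspace_fractafold_bundle
    using maps by blast
qed

text \<open>The trace of an image on level \<open>n\<close> is the image of the trace on level
  \<open>Suc n\<close>. There \<open>U\<close> can be exchanged for a product-open \<open>W\<close>,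
  whose image is open in the product.\<close>

lemma open_map_bundle_shift:
  assumes "nondegenerate_ifs N F" "\<forall>i\<in>{1..N}. surj (F i)"
    "\<And>i. i \<in> {1..N} \<Longrightarrow> F i ` K \<subseteq> K"
  shows "open_map (fractafold_bundle N F K) (fractafold_bundle N F K) (bundle_shift F)"
  unfolding open_map_def
proof (intro allI impI)
  fix U assume U: "openin (fractafold_bundle N F K) U"
  let ?L = "bundle_level N F K" and ?P = "prod_topology (shift_space N) euclidean"
  have int: "bundle_shift F ` S \<inter> ?L n = bundle_shift F ` (S \<inter> ?L (Suc n))"
    if "S \<subseteq> streams {1..N} \<times> UNIV" for S n
  proof -
    have "bundle_shift F z \<in> ?L n \<longleftrightarrow> z \<in> ?L (Suc n)" if "z \<in> S" for z
    proof -
      have "fst z \<in> streams {1..N}" using that \<open>S \<subseteq> _\<close> by auto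
      then show ?thesis using bundle_shift_mem_level[of "fst z" N F "snd z"] by simp
    qed
    then show ?thesis by blast
  qed
  have "U \<subseteq> streams {1..N} \<times> UNIV"
    using U bundle_level_subset unfolding openin_fractafold_bundle by fast
  note intU = int[OF this]
  show "openin (fractafold_bundle N F K) (bundle_shift F ` U)"
    unfolding openin_fractafold_bundle
  proof (intro conjI allI)
    \<comment> \<open>Continuity supplies here that \<open>L\<close> is mapped into itself.\<close>
    have "continuous_map (fractafold_bundle N F K) (fractafold_bundle N F K) (bundle_shift F)"
      using assms(1,3) by (rule continuous_map_bundle_shift)
    from order_trans[OF image_mono[OF openin_subset[OF U]] continuous_map_image_subset_topspace[OF this]]
    show "bundle_shift F ` U \<subseteq> (\<Union>n. ?L n)"
      by simp
  next
    fix n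
    obtain W where W: "openin ?P W" "U \<inter> ?L (Suc n) = W \<inter> ?L (Suc n)"
      using U unfolding openin_fractafold_bundle openin_bundle_level_top by blast
    then have "bundle_shift F ` U \<inter> ?L n = bundle_shift F ` W \<inter> ?L n"
      using intU int[of W] by (simp add: openin_shift_prod)
    then show "openin (bundle_level_top N F K n) (bundle_shift F ` U \<inter> ?L n)"
      unfolding openin_bundle_level_top
      using bundle_shift_image_open[OF assms(1,2) W(1)] by blast
  qed
qed

text \<open>The shift forgets only the first letter, which is fixed to \<open>i\<close> on this
  set.\<close>

lemma inj_on_bundle_shift:
  assumes "inj (F i)"
  shows "inj_on (bundle_shift F) {z. shd (fst z) = i}"
proof (rule inj_onI; clarify)
  fix x t y s
  assume "bundle_shift F (x, t) = bundle_shift F (y, s)"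
    "shd (fst (y, s)) = shd (fst (x, t))" "i = shd (fst (x, t))"
  then show "x = y \<and> t = s"
    using assms by (auto simp: bundle_shift_def inj_eq intro: stream.expand)
qed

lemma local_homeomorphism_bundle_shift:
  fixes F :: "nat \<Rightarrow> 't::metric_space \<Rightarrow> 't"
  assumes "nondegenerate_ifs N F" "\<forall>i\<in>{1..N}. surj (F i)"
    "\<And>i. i \<in> {1..N} \<Longrightarrow> F i ` K \<subseteq> K"
  shows "local_homeomorphism (fractafold_bundle N F K) (fractafold_bundle N F K) (bundle_shift F)"
proof (rule local_homeomorphismI)
  fix z assume z: "z \<in> topspace (fractafold_bundle N F K)"
  define i where "i = shd (fst z)"
  let ?W = "{z \<in> streams {1..N} \<times> (UNIV :: 't set). shd (fst z) = i}"
  have zs: "z \<in> streams {1..N} \<times> UNIV" using z bundle_level_subset by fastforce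
  then have "i \<in> {1..N}" unfolding i_def mem_Times_iff using streams_shd by blast
  then have "inj (F i)" using assms(1) nondegenerate_ifs_inj by blast
  then have "inj_on (bundle_shift F) (?W \<inter> (\<Union>n. bundle_level N F K n))"
    by (rule inj_on_subset[OF inj_on_bundle_shift]) auto
  \<comment> \<open>A prefix of length one decides membership in \<open>?W\<close>, which makes
    \<open>?W\<close> open.\<close>
  moreover have cyl: "cylinder N (stake (Suc 0) x) \<times> UNIV \<subseteq> ?W" if "shd x = i" for x
    using that by (auto simp: mem_cylinder_stake_Suc simp del: stake.simps)
  have "openin (prod_topology (shift_space N) euclidean) ?W"
    unfolding openin_shift_prod
  proof (intro conjI ballI)
    fix z assume "z \<in> ?W"
    then have "shd (fst z) = i" by blast
    from cyl[OF this] open_UNIV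
    show "case z of (x, t) \<Rightarrow> \<exists>n V. open V \<and> t \<in> V \<and> cylinder N (stake n x) \<times> V \<subseteq> ?W"
      unfolding split_beta by (meson UNIV_I)
  qed blast
  then have "openin (fractafold_bundle N F K) (?W \<inter> (\<Union>n. bundle_level N F K n))"
    by (rule openin_fractafold_bundle_Int)
  ultimately show "\<exists>U. openin (fractafold_bundle N F K) U \<and> z \<in> U \<and> inj_on (bundle_shift F) U"
    using z zs by (intro exI[of _ "?W \<inter> (\<Union>n. bundle_level N F K n)"]) (simp add: i_def)
next
  show "continuous_map (fractafold_bundle N F K) (fractafold_bundle N F K) (bundle_shift F)"
    using assms(1,3) by (rule continuous_map_bundle_shift)
  show "open_map (fractafold_bundle N F K) (fractafold_bundle N F K) (bundle_shift F)"
    using assms by (rule open_map_bundle_shift)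
qed

section \<open>Essential freeness\<close>

text \<open>Coincidences between iterates thus descend to coincidences between tails of the
  sequence, whatever \<open>F\<close> and the second coordinate are.\<close>

lemma fst_bundle_shift_funpow: "fst ((bundle_shift F ^^ k) z) = sdrop k (fst z)"
  by (induction k) (auto simp: bundle_shift_def split_beta simp flip: sdrop_stl)

section \<open>A sequence that is not eventually periodic\<close>

text \<open>The gaps between successive letters \<open>2\<close> grow without bound, which excludes
  eventual periodicity.\<close>

definition pow2_stream :: "nat stream" where
  "pow2_stream = smap (\<lambda>j. if \<exists>q. j = 2 ^ q then 2 else 1) nats"

lemma snth_pow2_stream: "pow2_stream !! j = (if \<exists>q. j = 2 ^ q then 2 else 1)"
  by (simp add: pow2_stream_def)

lemma pow2_stream_in: "2 \<le> N \<Longrightarrow> pow2_stream \<in> streams {1..N}"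
  by (auto simp: streams_iff_snth snth_pow2_stream)

text \<open>For \<open>k < l\<close>, equal tails would move the \<open>2\<close> at position
  \<open>k + j = 2 ^ q\<close> to position \<open>l + j\<close>, which lies strictly between
  \<open>2 ^ q\<close> and \<open>2 ^ Suc q\<close>.\<close>

lemma pow2_stream_not_eventually_periodic:
  assumes "sdrop k pow2_stream = sdrop l pow2_stream"
  shows "k = l"
proof -
  have False if kl: "k < l" and eq: "sdrop k pow2_stream = sdrop l pow2_stream" for k l :: nat
  proof -
    \<comment> \<open>This bound serves twice: \<open>k < 2 ^ q\<close> yields \<open>j\<close>, and
      the displacement \<open>l - k\<close> stays below the gap \<open>2 ^ q\<close> to the next
      power.\<close>
    obtain q where "l < 2 ^ q" using less_exp by blast
    then obtain j where j: "k + j = 2 ^ q" using kl by (metis le_Suc_ex less_imp_le order.strict_trans)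
    have "pow2_stream !! (k + j) = pow2_stream !! (l + j)"
      using eq by (metis sdrop_snth)
    then obtain p where "l + j = 2 ^ p"
      using j by (auto simp: snth_pow2_stream split: if_splits)
    then have "(2::nat) ^ q < 2 ^ p" "(2::nat) ^ p < 2 ^ Suc q"
      using kl j \<open>l < 2 ^ q\<close> unfolding power_Suc by linarith+
    then have "q < p \<and> p < Suc q" by (meson one_less_numeral_iff power_less_imp_less_exp semiring_norm(76))
    then show False by linarith
  qed
  then show ?thesis using assms by (metis nat_neq_iff)
qed

text \<open>Dropping \<open>length u\<close> further letters on both sides removes the prefix
  \<open>u\<close> altogether.\<close>

lemma shift_pow2_stream_not_eventually_periodic:
  assumes "sdrop k (u @- pow2_stream) = sdrop l (u @- pow2_stream)"
  shows "k = l"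
proof -
  let ?m = "length u"
  have "sdrop (j + ?m) (u @- pow2_stream) = sdrop j pow2_stream" for j
    by (metis add.commute sdrop_add sdrop_shift drop_all order_refl shift.simps(1) diff_self_eq_0 sdrop.simps(1))
  moreover have "sdrop (k + ?m) (u @- pow2_stream) = sdrop (l + ?m) (u @- pow2_stream)"
    using assms by (metis sdrop_add)
  ultimately show ?thesis using pow2_stream_not_eventually_periodic by metis
qed

lemma essentially_free_bundle_shift:
  fixes F :: "nat \<Rightarrow> 't::topological_space \<Rightarrow> 't"
  assumes "2 \<le> N"
  shows "essentially_free (fractafold_bundle N F K) (bundle_shift F)"
proof -
  let ?Y = "fractafold_bundle N F K"
  let ?S = "{z \<in> topspace ?Y. \<forall>k l. (bundle_shift F ^^ k) z = (bundle_shift F ^^ l) z \<longrightarrow> k = l}"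
  have "z \<in> ?Y closure_of ?S" if z: "z \<in> topspace ?Y" for z
    unfolding in_closure_of
  proof (intro conjI allI impI z)
    fix U assume U: "z \<in> U \<and> openin ?Y U"
    obtain x t n where zxt: "z = (x, t)" and zn: "z \<in> bundle_level N F K n"
      using z by (metis UN_E surj_pair topspace_fractafold_bundle)
    \<comment> \<open>Openness of \<open>U\<close> is given level by level, so \<open>U\<close> is
      replaced by \<open>W\<close> on a level that contains \<open>z\<close>; the approximating
      point must stay on that level.\<close>
    obtain W where W: "openin (prod_topology (shift_space N) euclidean) W"
      "U \<inter> bundle_level N F K n = W \<inter> bundle_level N F K n"
      using U unfolding openin_fractafold_bundle openin_bundle_level_top by blast
    then have "(x, t) \<in> W" using U zn zxt by blast
    then obtain m V where m: "t \<in> V" "cylinder N (stake m x) \<times> V \<subseteq> W"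
      using W(1) unfolding openin_shift_prod by fast
    \<comment> \<open>Agreement on \<open>m\<close> letters keeps \<open>(y, t)\<close> in
      \<open>W\<close>; agreement on \<open>n\<close> letters keeps it on level \<open>n\<close>,
      where \<open>W\<close> and \<open>U\<close> coincide.\<close>
    define u where "u = stake (max m n) x"
    define y where "y = u @- pow2_stream"
    have x: "x \<in> streams {1..N}" using zn zxt by (simp add: mem_bundle_level)
    then have ys: "y \<in> streams {1..N}"
      using set_stake_subset[OF x] pow2_stream_in[OF assms] unfolding y_def u_def streams_iff_sset
      by (simp only: sset_shift Un_least)
    have "stake (max m n) y = stake (max m n) x"
      by (simp add: y_def u_def stake_shift)
    then have st: "stake m y = stake m x" "stake n y = stake n x"
      using stake_eq_mono by (metis max.cobounded1, metis max.cobounded2)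
    have "(y, t) \<in> W" using m st ys by (auto simp: mem_cylinder_stake)
    moreover have yn: "(y, t) \<in> bundle_level N F K n"
      using zn st ys by (simp add: zxt mem_bundle_level)
    ultimately have "(y, t) \<in> U" using W(2) by blast
    moreover have "k = l" if "(bundle_shift F ^^ k) (y, t) = (bundle_shift F ^^ l) (y, t)" for k l
      using that fst_bundle_shift_funpow[of _ F "(y, t)"] shift_pow2_stream_not_eventually_periodic
      unfolding y_def by (metis fst_conv)
    ultimately show "\<exists>y. y \<in> ?S \<and> y \<in> U" using yn by auto
  qed
  then have "topspace ?Y \<subseteq> ?Y closure_of ?S" by (rule subsetI)
  then show ?thesis
    unfolding essentially_free_def by (rule subset_antisym[OF closure_of_subset_topspace])
qed

section \<open>Topological principality of Renault--Deaconu groupoids\<close>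

lemma RD_groupoid_simps [simp]:
  "arrows (RD_groupoid Y \<tau>) = RD_arrows Y \<tau>"
  "gsrc (RD_groupoid Y \<tau>) (x, k, y) = (y, 0, y)"
  "grng (RD_groupoid Y \<tau>) (x, k, y) = (x, 0, x)"
  "gtop (RD_groupoid Y \<tau>) = topology_generated_by (RD_basis Y \<tau>)"
  by (simp_all add: RD_groupoid_def)

lemma unit_in_RD_arrows: "y \<in> topspace Y \<Longrightarrow> (y, 0, y) \<in> RD_arrows Y \<tau>"
  unfolding RD_arrows_def by fastforce

lemma gunits_RD_groupoid: "gunits (RD_groupoid Y \<tau>) = (\<lambda>y. (y, 0, y)) ` topspace Y"
proof
  show "gunits (RD_groupoid Y \<tau>) \<subseteq> (\<lambda>y. (y, 0, y)) ` topspace Y"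
    by (auto simp: gunits_def RD_arrows_def)
  show "(\<lambda>y. (y, 0, y)) ` topspace Y \<subseteq> gunits (RD_groupoid Y \<tau>)"
    unfolding gunits_def using unit_in_RD_arrows by (force simp: image_iff)
qed

lemma continuous_map_RD_unit:
  "continuous_map Y (topology_generated_by (RD_basis Y \<tau>)) (\<lambda>y. (y, 0, y))"
proof (rule continuous_on_generated_topo)
  fix B assume "B \<in> RD_basis Y \<tau>"
  then obtain m n U V where B: "B = RD_basic_set \<tau> m n U V" and UV: "openin Y U" "openin Y V"
    unfolding RD_basis_def by blast
  \<comment> \<open>The middle entry \<open>0\<close> forces \<open>m = n\<close>, and then the
    equation between the iterates of \<open>y\<close> holds trivially.\<close>
  have "(\<lambda>y. (y, 0, y)) -` B \<inter> topspace Y = (if m = n then U \<inter> V else {})"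
    using openin_subset[OF UV(1)] by (auto simp: B RD_basic_set_def)
  then show "openin Y ((\<lambda>y. (y, 0, y)) -` B \<inter> topspace Y)"
    using UV by (simp add: openin_Int)
next
  \<comment> \<open>For \<open>m = n = 0\<close> both iterates are the identity, so one basic set
    contains all units.\<close>
  have "RD_basic_set \<tau> 0 0 (topspace Y) (topspace Y) \<in> RD_basis Y \<tau>"
    unfolding RD_basis_def by force
  moreover have "(y, 0, y) \<in> RD_basic_set \<tau> 0 0 (topspace Y) (topspace Y)"
    if "y \<in> topspace Y" for y using that by (simp add: RD_basic_set_def)
  ultimately show "(\<lambda>y. (y, 0, y)) ` topspace Y \<subseteq> \<Union> (RD_basis Y \<tau>)"
    by blast
qed

lemma topologically_principal_RD_groupoid:
  assumes "essentially_free Y \<tau>"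
  shows "topologically_principal (RD_groupoid Y \<tau>)"
proof -
  let ?G = "RD_groupoid Y \<tau>" and ?e = "\<lambda>y. (y, 0, y) :: 'a \<times> int \<times> 'a"
  let ?S = "{z \<in> topspace Y. \<forall>k l. (\<tau> ^^ k) z = (\<tau> ^^ l) z \<longrightarrow> k = l}"
  let ?I = "{u \<in> gunits ?G. \<forall>\<gamma>\<in>arrows ?G. gsrc ?G \<gamma> = u \<and> grng ?G \<gamma> = u \<longrightarrow> \<gamma> = u}"
  let ?T = "subtopology (gtop ?G) (gunits ?G)"
  have "continuous_map Y ?T ?e"
    by (auto simp: continuous_map_in_subtopology continuous_map_RD_unit gunits_RD_groupoid)
  then have "?e ` (Y closure_of ?S) \<subseteq> ?T closure_of (?e ` ?S)"
    by (rule continuous_map_image_closure_subset)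
  then have "gunits ?G \<subseteq> ?T closure_of (?e ` ?S)"
    using assms by (simp add: essentially_free_def gunits_RD_groupoid)
  \<comment> \<open>An isotropy arrow at \<open>y\<close> is \<open>(y, m - n, y)\<close> with equal
    \<open>m\<close>-th and \<open>n\<close>-th iterates of \<open>y\<close>; on \<open>?S\<close>
    this gives \<open>m = n\<close>, so the arrow is the unit.\<close>
  also have "?e ` ?S \<subseteq> ?I"
    by (auto simp: gunits_RD_groupoid RD_arrows_def)
  then have "?T closure_of (?e ` ?S) \<subseteq> ?T closure_of ?I" by (rule closure_of_mono)
  finally have "gunits ?G \<subseteq> ?T closure_of ?I" .
  moreover have "?T closure_of ?I \<subseteq> gunits ?G"
    using closure_of_subset_topspace[of ?T ?I] by simp
  ultimately show ?thesis unfolding topologically_principal_def by (rule subset_antisym[rotated])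
qed

theorem proposition3p7:
  fixes N :: nat
    and F :: "nat \<Rightarrow> 't::complete_space \<Rightarrow> 't"
    and K :: "'t set"
  assumes "2 \<le> N"
    and "nondegenerate_ifs N F"
    and "\<forall>i\<in>{1..N}. surj (F i)"
    and "is_attractor N F K"
  shows "local_homeomorphism (fractafold_bundle N F K) (fractafold_bundle N F K) (bundle_shift F) \<and>
    essentially_free (fractafold_bundle N F K) (bundle_shift F) \<and>
    topologically_principal (RD_groupoid (fractafold_bundle N F K) (bundle_shift F))"
proof -
  have "F i ` K \<subseteq> K" if "i \<in> {1..N}" for i
    using assms(4) that unfolding is_attractor_def by blast
  with assms(2,3)
  have "local_homeomorphism (fractafold_bundle N F K) (fractafold_bundle N F K) (bundle_shift F)"
    by (rule local_homeomorphism_bundle_shift)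
  moreover have free: "essentially_free (fractafold_bundle N F K) (bundle_shift F)"
    using assms(1) by (rule essentially_free_bundle_shift)
  moreover from free
  have "topologically_principal (RD_groupoid (fractafold_bundle N F K) (bundle_shift F))"
    by (rule topologically_principal_RD_groupoid)
  ultimately show ?thesis by (intro conjI)
qed

end
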